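(* Let $k,d,n$ be positive integers and let $K$ be an algebraically closed field of characteristic $0$ or $p>kd$. Let $W$ be a $K$-vector space with basis $w_0,\dots,w_n$ and dual basis $x_0,\dots,x_n$ of $W^*$. Let $f\in\mathrm{Sym}^{kd}(W^* )$, let $q_0,\dots,q_r$ be a basis of $\mathrm{Sym}^d(W^* )$, and let $q_0^*,\dots,q_r^*\in\mathrm{Sym}^d(W)$ denote its dual basis. Then $$\frac{(kd)!}{d!^k}\,f=\sum_{0\le i_1,\dots,i_k\le r}\mathrm{D}(q_{i_1}^*\cdots q_{i_k}^*,f)\,q_{i_1}\cdots q_{i_k}.$$
   Context: $\mathrm{D}:\mathrm{Sym}(W)\times\mathrm{Sym}(W^* )\to\mathrm{Sym}(W^* )$ is the $K$-bilinear map defined by $\mathrm{D}(w_0^{\alpha_0}\cdots w_n^{\alpha_n},P)=\frac{\partial^{\alpha_0+\cdots+\alpha_n}P}{\partial x_0^{\alpha_0}\cdots\partial x_n^{\alpha_n}}$. The dual basis of a basis $q_0,\dots,q_r$ of $\mathrm{Sym}^d(W^* )$ is the family $q_0^*,\dots,q_r^*\in\mathrm{Sym}^d(W)$ such that $\mathrm{D}(q_i^*,q_j)=\delta_{i,j}$ for all $0\le i,j\le r$. *)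

theory Defs
  imports
    "HOL-Library.Poly_Mapping"
    "HOL-Library.FuncSet"
    "HOL-Computational_Algebra.Computational_Algebra"
begin

text \<open>
  A basis \<open>w\<^sub>0, \<dots>, w\<^sub>n\<close> of \<open>W\<close> and its dual basis \<open>x\<^sub>0, \<dots>, x\<^sub>n\<close> of \<open>W\<^sup>*\<close> being fixed,
  \<open>Sym(W) = K[w\<^sub>0, \<dots>, w\<^sub>n]\<close> and \<open>Sym(W\<^sup>*) = K[x\<^sub>0, \<dots>, x\<^sub>n]\<close>.  Both are modelled by the library
  ring of polynomials in variables indexed by \<open>nat\<close>, the variable \<open>i\<close> standing for \<open>w\<^sub>i\<close> in the
  first ring and for \<open>x\<^sub>i\<close> in the second; \<open>sym_comp\<close> below restricts to the variables
  \<open>0, \<dots>, n\<close>.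
\<close>

type_synonym monom_exp = "nat \<Rightarrow>\<^sub>0 nat"
type_synonym 'k mpol = "monom_exp \<Rightarrow>\<^sub>0 'k"

definition scal :: "'k::field \<Rightarrow> 'k mpol \<Rightarrow> 'k mpol"
  where "scal c p = Poly_Mapping.single 0 c * p"

global_interpretation mpol: vector_space "scal :: 'k::field \<Rightarrow> 'k mpol \<Rightarrow> 'k mpol"
  defines mpol_span = mpol.span
    and mpol_dependent = mpol.dependent
  by unfold_locales
    (simp_all add: scal_def distrib_left distrib_right single_add mult_single flip: mult.assoc)

lemma lookup_scal [simp]:
  "Poly_Mapping.lookup (scal c p) m = c * Poly_Mapping.lookup p m"
proof -
  have "scal c p = Poly_Mapping.map ((*) c) p"
    by (simp add: scal_def mult_map_scale_conv_mult)
  then show ?thesis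
    by (simp add: Poly_Mapping.map.rep_eq when_def)
qed

definition monom_deg :: "monom_exp \<Rightarrow> nat"
  where "monom_deg m = (\<Sum>i\<in>Poly_Mapping.keys m. Poly_Mapping.lookup m i)"

text \<open>The degree-\<open>d\<close> component of the symmetric algebra of a space of dimension \<open>n + 1\<close>.\<close>

definition sym_comp :: "nat \<Rightarrow> nat \<Rightarrow> 'k::field mpol set"
  where "sym_comp n d =
    {p. \<forall>m\<in>Poly_Mapping.keys p. Poly_Mapping.keys m \<subseteq> {..n} \<and> monom_deg m = d}"

text \<open>The summands with \<open>lookup m i = 0\<close> vanish, so the truncated subtraction in the exponent
  is harmless.\<close>

definition partial :: "nat \<Rightarrow> 'k::field mpol \<Rightarrow> 'k mpol"
  where "partial i p =
    (\<Sum>m\<in>Poly_Mapping.keys p.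
       Poly_Mapping.single (m - Poly_Mapping.single i 1)
         (of_nat (Poly_Mapping.lookup m i) * Poly_Mapping.lookup p m))"

definition partials :: "monom_exp \<Rightarrow> 'k::field mpol \<Rightarrow> 'k mpol"
  where "partials \<alpha> p =
    fold (\<lambda>i. partial i ^^ Poly_Mapping.lookup \<alpha> i) (sorted_list_of_set (Poly_Mapping.keys \<alpha>)) p"

definition DD :: "'k::field mpol \<Rightarrow> 'k mpol \<Rightarrow> 'k mpol"
  where "DD a p =
    (\<Sum>\<alpha>\<in>Poly_Mapping.keys a. scal (Poly_Mapping.lookup a \<alpha>) (partials \<alpha> p))"

definition basis_upto :: "'k::field mpol set \<Rightarrow> nat \<Rightarrow> (nat \<Rightarrow> 'k mpol) \<Rightarrow> bool"
  where "basis_upto V r q \<longleftrightarrow>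
    inj_on q {..r} \<and> \<not> mpol_dependent (q ` {..r}) \<and> mpol_span (q ` {..r}) = V"

definition dual_basis_of ::
  "nat \<Rightarrow> nat \<Rightarrow> nat \<Rightarrow> (nat \<Rightarrow> 'k::field mpol) \<Rightarrow> (nat \<Rightarrow> 'k mpol) \<Rightarrow> bool"
  where "dual_basis_of n d r q qs \<longleftrightarrow>
    (\<forall>i\<le>r. qs i \<in> sym_comp n d) \<and>
    (\<forall>i\<le>r. \<forall>j\<le>r. DD (qs i) (q j) = (if i = j then 1 else 0))"

text \<open>\<open>DD\<close> is the bilinear map given on monomials by iterated partial derivatives.\<close>

lemma lookup_partial:
  "Poly_Mapping.lookup (partial i p) m =
    of_nat (Poly_Mapping.lookup m i + 1) * Poly_Mapping.lookup p (m + Poly_Mapping.single i 1)"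
proof -
  let ?e = "Poly_Mapping.single i (1::nat)"
  have *: "Poly_Mapping.lookup (Poly_Mapping.single (m' - ?e)
        (of_nat (Poly_Mapping.lookup m' i) * Poly_Mapping.lookup p m')) m =
      (if m' = m + ?e then of_nat (Poly_Mapping.lookup m' i) * Poly_Mapping.lookup p m' else 0)"
    for m'
  proof (cases "Poly_Mapping.lookup m' i = 0")
    case True
    then show ?thesis by (simp only: of_nat_0 mult_zero_left single_zero lookup_zero if_cancel)
  next
    case False
    have "m' - ?e + ?e = m'"
      by (rule poly_mapping_eqI) (use False in \<open>auto simp: lookup_add lookup_minus lookup_single when_def\<close>)
    then have "m' - ?e = m \<longleftrightarrow> m' = m + ?e"
      by (metis add_diff_cancel_right')
    then show ?thesis by (simp add: lookup_single when_def)
  qed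
  show ?thesis
    unfolding partial_def lookup_sum *
    by (auto simp: sum.delta' lookup_add lookup_single in_keys_iff)
qed

lemma partial_add: "partial i (p + p') = partial i p + partial i p'"
  by (rule poly_mapping_eqI) (simp add: lookup_partial lookup_add algebra_simps)

lemma partial_scal: "partial i (scal c p) = scal c (partial i p)"
  by (rule poly_mapping_eqI) (simp add: lookup_partial algebra_simps)

lemma partials_add: "partials \<alpha> (p + p') = partials \<alpha> p + partials \<alpha> p'"
proof -
  have pow: "(partial i ^^ k) (u + v) = (partial i ^^ k) u + (partial i ^^ k) v"
    for i k and u v :: "'a mpol"
    by (induction k) (simp_all add: partial_add)
  have "fold (\<lambda>i. partial i ^^ Poly_Mapping.lookup \<alpha> i) is (u + v) =
      fold (\<lambda>i. partial i ^^ Poly_Mapping.lookup \<alpha> i) is u +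
      fold (\<lambda>i. partial i ^^ Poly_Mapping.lookup \<alpha> i) is v" for "is" and u v :: "'a mpol"
    by (induction "is" arbitrary: u v) (simp_all add: pow)
  then show ?thesis by (simp add: partials_def)
qed

lemma partials_scal: "partials \<alpha> (scal c p) = scal c (partials \<alpha> p)"
proof -
  have pow: "(partial i ^^ k) (scal c u) = scal c ((partial i ^^ k) u)" for i k u
    by (induction k) (simp_all add: partial_scal)
  have "fold (\<lambda>i. partial i ^^ Poly_Mapping.lookup \<alpha> i) is (scal c u) =
      scal c (fold (\<lambda>i. partial i ^^ Poly_Mapping.lookup \<alpha> i) is u)" for "is" u
    by (induction "is" arbitrary: u) (simp_all add: pow)
  then show ?thesis by (simp add: partials_def)
qed

lemma DD_monomial: "DD (Poly_Mapping.single \<alpha> 1) p = partials \<alpha> p"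
  by (simp add: DD_def)

lemma DD_superset:
  assumes "finite A" "Poly_Mapping.keys a \<subseteq> A"
  shows "DD a p = (\<Sum>\<alpha>\<in>A. scal (Poly_Mapping.lookup a \<alpha>) (partials \<alpha> p))"
  unfolding DD_def using assms
  by (intro sum.mono_neutral_left) (auto simp: in_keys_iff)

lemma DD_add_left: "DD (a + b) p = DD a p + DD b p"
proof -
  let ?A = "Poly_Mapping.keys a \<union> Poly_Mapping.keys b"
  have "Poly_Mapping.keys (a + b) \<subseteq> ?A" by (rule keys_add)
  then show ?thesis
    by (simp add: DD_superset[of ?A] lookup_add mpol.scale_left_distrib sum.distrib)
qed

lemma DD_scal_left: "DD (scal c a) p = scal c (DD a p)"
proof -
  have "Poly_Mapping.keys (scal c a) \<subseteq> Poly_Mapping.keys a"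
    by (auto simp: in_keys_iff)
  then show ?thesis
    by (simp add: DD_superset[of "Poly_Mapping.keys a"] mpol.scale_sum_right)
qed

lemma DD_add_right: "DD a (p + p') = DD a p + DD a p'"
  by (simp add: DD_def partials_add mpol.scale_right_distrib sum.distrib)

lemma DD_scal_right: "DD a (scal c p) = scal c (DD a p)"
  by (simp add: DD_def partials_scal mpol.scale_sum_right mult.commute)

end

theory Submission
  imports Defs
begin

text \<open>
  By induction on \<open>k\<close> and \<open>D(ab, f) = D(a, D(b, f))\<close>, it suffices that
  \<open>\<Sum>\<^sub>i q\<^sub>i D(q\<^sub>i\<^sup>*, f) = (e choose d) f\<close> for \<open>f\<close> of degree \<open>e\<close>. Expanding each monomial \<open>x\<^sup>\<alpha>\<close> of
  degree \<open>d\<close> in the basis \<open>q\<close> turns the left-hand side into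
  \<open>\<Sum>\<^sub>\<alpha> x\<^sup>\<alpha> \<partial>\<^sup>\<alpha> f / \<alpha>!\<close>, whose coefficient at \<open>x\<^sup>m\<close> is that of \<open>f\<close> times
  \<open>\<Sum>\<^sub>\<alpha> \<Prod>\<^sub>i (m\<^sub>i choose \<alpha>\<^sub>i)\<close>, evaluated by Vandermonde's identity.
\<close>

section \<open>Factorials, binomials and sums over index families\<close>

lemma sum_PiE_insert:
  assumes "x \<notin> S"
  shows "(\<Sum>g\<in>PiE (insert x S) T. h g) = (\<Sum>y\<in>T x. \<Sum>g\<in>PiE S T. h (g(x := y)))"
  unfolding PiE_insert_eq sum.reindex[OF inj_combinator[OF assms]]
  by (simp add: sum.cartesian_product case_prod_unfold)

text \<open>The quotient is a multinomial coefficient. Through this, d! being nonzero in the field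
  passes to \<alpha>! for every exponent \<alpha> of degree d.\<close>

lemma prod_fact_dvd_fact_sum:
  assumes "finite S"
  shows "(\<Prod>i\<in>S. fact (f i)) dvd (fact (\<Sum>i\<in>S. f i) :: nat)"
  using assms
proof induction
  case (insert i S)
  have "fact (f i) * fact (sum f S) dvd (fact (f i + sum f S) :: nat)"
    by (rule fact_fact_dvd_fact)
  then show ?case
    using insert mult_dvd_mono[OF dvd_refl insert.IH] by (auto intro: dvd_trans)
qed simp

lemma pochhammer_Suc_eq_fact_mult_binomial:
  "pochhammer (Suc m) k = fact k * ((m + k) choose k)"
proof -
  have "fact m * pochhammer (Suc m) k = (fact (m + k) :: nat)"
    using pochhammer_product'[of "1::nat" m k] by (simp add: pochhammer_fact)
  also have "\<dots> = fact m * (fact k * ((m + k) choose k))"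
    using binomial_fact_lemma[of k "m + k"] by (simp add: algebra_simps)
  finally show ?thesis by simp
qed

text \<open>A prime divides n! only if it is at most n.\<close>

lemma of_nat_fact_neq_0:
  assumes "CHAR('a::field) = 0 \<or> CHAR('a) > n"
  shows "(of_nat (fact n) :: 'a) \<noteq> 0"
proof
  assume "(of_nat (fact n) :: 'a) = 0"
  then have dvd: "CHAR('a) dvd fact n"
    by (simp add: of_nat_eq_0_iff_char_dvd)
  \<comment> \<open>Characteristic 0 is excluded here: 0 divides only 0, and n! is not 0.\<close>
  then have "CHAR('a) > n"
    using assms by (auto simp: fact_nonzero)
  moreover from this have "prime CHAR('a)"
    by (intro prime_CHAR_semidom) simp
  ultimately show False
    using dvd prime_dvd_fact_iff[of "CHAR('a)" n] by simp
qed

subsection \<open>Exponent vectors\<close>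

lemma monom_deg_superset:
  assumes "finite S" "Poly_Mapping.keys m \<subseteq> S"
  shows "monom_deg m = (\<Sum>i\<in>S. Poly_Mapping.lookup m i)"
  unfolding monom_deg_def using assms
  by (intro sum.mono_neutral_left) (auto simp: in_keys_iff)

lemma monom_deg_zero [simp]: "monom_deg 0 = 0"
  by (simp add: monom_deg_def)

lemma monom_deg_single [simp]: "monom_deg (Poly_Mapping.single i k) = k"
  by (simp add: monom_deg_def)

lemma monom_deg_add [simp]: "monom_deg (a + b) = monom_deg a + monom_deg b"
  using keys_add[of a b]
  by (simp add: monom_deg_superset[of "Poly_Mapping.keys a \<union> Poly_Mapping.keys b"]
      lookup_add sum.distrib)

lemma monom_deg_eq_0_iff [simp]: "monom_deg a = 0 \<longleftrightarrow> a = 0"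
  by (auto simp: monom_deg_def in_keys_iff poly_mapping_eq_iff fun_eq_iff)

lemma keys_add_nat: "Poly_Mapping.keys (a + b :: monom_exp) = Poly_Mapping.keys a \<union> Poly_Mapping.keys b"
  by (auto simp: in_keys_iff lookup_add)

text \<open>For \<open>S = {..n}\<close> these index the monomial basis of
  \<open>sym_comp n d\<close>; a general \<open>S\<close> permits induction on the set of
  variables.\<close>

definition exps :: "nat set \<Rightarrow> nat \<Rightarrow> monom_exp set"
  where "exps S d = {\<alpha>. Poly_Mapping.keys \<alpha> \<subseteq> S \<and> monom_deg \<alpha> = d}"

lemma exps_empty: "exps {} d = (if d = 0 then {0} else {})"
  by (auto simp: exps_def)

text \<open>Classifying exponents by the power \<open>k\<close> of the new variable \<open>i\<close>
  turns a sum over \<open>exps\<close> into the double sum of Vandermonde's identity.\<close>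

lemma exps_insert:
  "exps (insert i S) d = (\<lambda>(k, \<beta>). Poly_Mapping.single i k + \<beta>) ` (SIGMA k:{..d}. exps S (d - k))"
proof (intro equalityI subsetI)
  fix \<alpha> assume \<alpha>: "\<alpha> \<in> exps (insert i S) d"
  define k \<beta> where "k = Poly_Mapping.lookup \<alpha> i" and "\<beta> = Poly_Mapping.update i 0 \<alpha>"
  have eq: "\<alpha> = Poly_Mapping.single i k + \<beta>"
    by (rule poly_mapping_eqI) (simp add: k_def \<beta>_def lookup_add lookup_single lookup_update when_def)
  have "monom_deg \<alpha> = k + monom_deg \<beta>"
    by (simp add: eq)
  moreover have "Poly_Mapping.keys \<beta> \<subseteq> S"
    using \<alpha> by (auto simp: \<beta>_def keys_update exps_def)
  ultimately have "(k, \<beta>) \<in> (SIGMA k:{..d}. exps S (d - k))"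
    using \<alpha> by (auto simp: exps_def)
  then show "\<alpha> \<in> (\<lambda>(k, \<beta>). Poly_Mapping.single i k + \<beta>) ` (SIGMA k:{..d}. exps S (d - k))"
    using eq by force
next
  fix \<alpha> assume "\<alpha> \<in> (\<lambda>(k, \<beta>). Poly_Mapping.single i k + \<beta>) ` (SIGMA k:{..d}. exps S (d - k))"
  then show "\<alpha> \<in> exps (insert i S) d"
    by (auto simp: exps_def keys_add_nat split: if_splits)
qed

lemma inj_on_exps_insert:
  assumes "i \<notin> S"
  shows "inj_on (\<lambda>(k, \<beta>). Poly_Mapping.single i k + \<beta>) (SIGMA k:{..d}. exps S (d - k))"
proof (rule inj_onI, clarify)
  fix k l \<beta> \<gamma>
  assume \<beta>: "\<beta> \<in> exps S (d - k)" and \<gamma>: "\<gamma> \<in> exps S (d - l)"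
    and eq: "Poly_Mapping.single i k + \<beta> = Poly_Mapping.single i l + \<gamma>"
  have "Poly_Mapping.lookup \<beta> i = 0" "Poly_Mapping.lookup \<gamma> i = 0"
    using \<beta> \<gamma> assms by (auto simp: exps_def in_keys_iff)
  moreover have "Poly_Mapping.lookup (Poly_Mapping.single i k + \<beta>) i =
      Poly_Mapping.lookup (Poly_Mapping.single i l + \<gamma>) i"
    by (simp only: eq)
  ultimately have "k = l"
    by (simp add: lookup_add)
  then show "k = l \<and> \<beta> = \<gamma>"
    using eq by simp
qed

lemma finite_exps: "finite S \<Longrightarrow> finite (exps S d)"
  by (induction S arbitrary: d rule: finite_induct) (auto simp: exps_empty exps_insert)

text \<open>Both sides are the coefficient of t^d in the product of the (1 + t)^(m i). The induction
  splits off one variable and applies the two-term identity \<open>vandermonde\<close>.\<close>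

lemma vandermonde_exps:
  assumes "finite S"
  shows "(\<Sum>\<alpha>\<in>exps S d. \<Prod>i\<in>S. m i choose Poly_Mapping.lookup \<alpha> i) = (\<Sum>i\<in>S. m i) choose d"
  using assms
proof (induction S arbitrary: d)
  case empty
  then show ?case by (simp add: exps_empty)
next
  case (insert i S)
  have *: "(\<Prod>j\<in>insert i S. m j choose Poly_Mapping.lookup (Poly_Mapping.single i k + \<beta>) j) =
      (m i choose k) * (\<Prod>j\<in>S. m j choose Poly_Mapping.lookup \<beta> j)"
    if "\<beta> \<in> exps S (d - k)" for k \<beta>
  proof -
    have "Poly_Mapping.lookup \<beta> i = 0"
      using that insert.hyps by (auto simp: exps_def in_keys_iff)
    moreover have "(\<Prod>j\<in>S. m j choose Poly_Mapping.lookup (Poly_Mapping.single i k + \<beta>) j) =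
        (\<Prod>j\<in>S. m j choose Poly_Mapping.lookup \<beta> j)"
      using insert.hyps by (intro prod.cong) (auto simp: lookup_add lookup_single when_def)
    ultimately show ?thesis
      using insert.hyps by (simp add: lookup_add)
  qed
  have "(\<Sum>\<alpha>\<in>exps (insert i S) d. \<Prod>j\<in>insert i S. m j choose Poly_Mapping.lookup \<alpha> j) =
      (\<Sum>k\<le>d. \<Sum>\<beta>\<in>exps S (d - k). (m i choose k) * (\<Prod>j\<in>S. m j choose Poly_Mapping.lookup \<beta> j))"
    unfolding exps_insert sum.reindex[OF inj_on_exps_insert[OF insert.hyps(2)]]
    using insert.hyps
    by (subst sum.Sigma) (auto simp: finite_exps * intro!: sum.cong simp del: prod.insert)
  also have "\<dots> = (\<Sum>k\<le>d. (m i choose k) * ((\<Sum>i\<in>S. m i) choose (d - k)))"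
    by (simp add: insert.IH flip: sum_distrib_left)
  also have "\<dots> = (\<Sum>i\<in>insert i S. m i) choose d"
    using insert.hyps by (simp add: vandermonde)
  finally show ?case .
qed

text \<open>The product divides d!, which is nonzero in the field; hence the divided powers
  x^\<alpha>/\<alpha>! make sense.\<close>

lemma of_nat_prod_fact_neq_0:
  assumes "CHAR('a::field) = 0 \<or> CHAR('a) > d" "\<alpha> \<in> exps {..n} d"
  shows "(of_nat (\<Prod>i\<le>n. fact (Poly_Mapping.lookup \<alpha> i)) :: 'a) \<noteq> 0"
proof -
  have "(\<Prod>i\<le>n. fact (Poly_Mapping.lookup \<alpha> i)) dvd (fact d :: nat)"
    using assms(2) prod_fact_dvd_fact_sum[of "{..n}" "Poly_Mapping.lookup \<alpha>"]
    by (auto simp: exps_def monom_deg_superset[of "{..n}"])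
  then show ?thesis
    using of_nat_fact_neq_0[OF assms(1)] by (metis dvd_def mult_eq_0_iff of_nat_mult)
qed

subsection \<open>Coefficients of derivatives\<close>

text \<open>This is (m + \<alpha>)!/m!, the factor with which the derivative of order \<alpha> sends
  x^(m + \<alpha>) to x^m, written without division.\<close>

definition rising :: "monom_exp \<Rightarrow> monom_exp \<Rightarrow> nat"
  where "rising \<alpha> m =
    (\<Prod>i\<in>Poly_Mapping.keys \<alpha>. pochhammer (Suc (Poly_Mapping.lookup m i)) (Poly_Mapping.lookup \<alpha> i))"

lemma rising_superset:
  assumes "finite S" "Poly_Mapping.keys \<alpha> \<subseteq> S"
  shows "rising \<alpha> m = (\<Prod>i\<in>S. pochhammer (Suc (Poly_Mapping.lookup m i)) (Poly_Mapping.lookup \<alpha> i))"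
  unfolding rising_def using assms
  by (intro prod.mono_neutral_left) (auto simp: in_keys_iff)

text \<open>The quotient (m + \<alpha> + \<beta>)!/m! is split at (m + \<alpha>)!; this is what
  makes derivatives compose.\<close>

lemma rising_add: "rising (\<alpha> + \<beta>) m = rising \<alpha> m * rising \<beta> (m + \<alpha>)"
  by (simp add: rising_superset[of "Poly_Mapping.keys \<alpha> \<union> Poly_Mapping.keys \<beta>"] keys_add_nat
      lookup_add pochhammer_product' flip: prod.distrib)

lemma lookup_partial_funpow:
  "Poly_Mapping.lookup ((partial i ^^ k) p) m =
    of_nat (pochhammer (Suc (Poly_Mapping.lookup m i)) k) *
      Poly_Mapping.lookup p (m + Poly_Mapping.single i k)"
  by (induction k arbitrary: m)
    (simp_all add: lookup_partial pochhammer_rec lookup_add add.assoc distrib_right flip: single_add)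

lemma lookup_partials:
  "Poly_Mapping.lookup (partials \<alpha> p) m =
    of_nat (rising \<alpha> m) * Poly_Mapping.lookup p (m + \<alpha>)"
proof -
  \<comment> \<open>The induction needs an arbitrary list of distinct variables instead of the
    sorted keys of \<alpha>.\<close>
  have fold: "Poly_Mapping.lookup (fold (\<lambda>i. partial i ^^ Poly_Mapping.lookup \<alpha> i) is p) m =
      of_nat (\<Prod>i\<in>set is. pochhammer (Suc (Poly_Mapping.lookup m i)) (Poly_Mapping.lookup \<alpha> i)) *
      Poly_Mapping.lookup p (m + (\<Sum>i\<in>set is. Poly_Mapping.single i (Poly_Mapping.lookup \<alpha> i)))"
    if "distinct is" for "is"
    using that
  proof (induction "is" arbitrary: p)
    case (Cons i "is")
    \<comment> \<open>The other derivatives shift only exponents of variables different from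
      \<open>i\<close>, so the rising factorial for \<open>i\<close> still starts from the exponent
      in \<open>m\<close>.\<close>
    have "Poly_Mapping.lookup (\<Sum>i\<in>set is. Poly_Mapping.single i (Poly_Mapping.lookup \<alpha> i)) i = 0"
      using Cons.prems by (auto simp: lookup_sum lookup_single when_def intro!: sum.neutral)
    with Cons show ?case
      by (simp add: lookup_partial_funpow lookup_add algebra_simps)
  qed simp
  have "(\<Sum>i\<in>Poly_Mapping.keys \<alpha>. Poly_Mapping.single i (Poly_Mapping.lookup \<alpha> i)) = \<alpha>"
    by (rule poly_mapping_eqI) (auto simp: lookup_sum lookup_single when_def in_keys_iff)
  then show ?thesis
    using fold[of "sorted_list_of_set (Poly_Mapping.keys \<alpha>)"]
    by (simp add: partials_def rising_def)
qed

lemma partials_partials: "partials \<alpha> (partials \<beta> p) = partials (\<alpha> + \<beta>) p"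
  by (rule poly_mapping_eqI) (simp add: lookup_partials rising_add algebra_simps)

section \<open>The pairing \<open>DD\<close>: linearity, composition and degrees\<close>

lemma DD_single: "DD (Poly_Mapping.single \<alpha> c) p = scal c (partials \<alpha> p)"
  by (simp add: DD_def)

lemma DD_zero_left [simp]: "DD 0 p = 0"
  by (simp add: DD_def)

lemma DD_sum_left: "DD (\<Sum>i\<in>I. a i) p = (\<Sum>i\<in>I. DD (a i) p)"
  by (induction I rule: infinite_finite_induct) (simp_all add: DD_add_left)

lemma DD_zero_right [simp]: "DD a 0 = 0"
  using DD_scal_right[of a 0 0] by simp

lemma DD_sum_right: "DD a (\<Sum>i\<in>I. p i) = (\<Sum>i\<in>I. DD a (p i))"
  by (induction I rule: infinite_finite_induct) (simp_all add: DD_add_right)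

lemma mpol_eq_sum_single:
  "p = (\<Sum>m\<in>Poly_Mapping.keys p. Poly_Mapping.single m (Poly_Mapping.lookup p m))"
  by (rule poly_mapping_eqI) (auto simp: lookup_sum lookup_single when_def in_keys_iff)

text \<open>The pairing is a module action. Expanding \<open>a\<close> and \<open>b\<close> into
  monomials reduces this to \<open>partials_partials\<close>.\<close>

lemma DD_mult: "DD (a * b) p = DD a (DD b p)"
proof -
  have single: "DD (Poly_Mapping.single \<alpha> c * Poly_Mapping.single \<beta> e) p =
      DD (Poly_Mapping.single \<alpha> c) (DD (Poly_Mapping.single \<beta> e) p)" for \<alpha> \<beta> c e
    by (simp add: mult_single DD_single partials_scal partials_partials)
  have "DD (Poly_Mapping.single \<alpha> c * b) p = DD (Poly_Mapping.single \<alpha> c) (DD b p)" for \<alpha> c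
    by (subst (1 2) mpol_eq_sum_single[of b])
      (simp only: sum_distrib_left DD_sum_left DD_sum_right single)
  then show ?thesis
    by (subst (1 2) mpol_eq_sum_single[of a]) (simp only: sum_distrib_right DD_sum_left)
qed

lemma lookup_DD:
  "Poly_Mapping.lookup (DD a p) m = (\<Sum>\<alpha>\<in>Poly_Mapping.keys a.
    Poly_Mapping.lookup a \<alpha> * (of_nat (rising \<alpha> m) * Poly_Mapping.lookup p (m + \<alpha>)))"
  by (simp add: DD_def lookup_sum lookup_partials)

lemma DD_in_sym_comp:
  assumes "a \<in> sym_comp n d" "p \<in> sym_comp n (e + d)"
  shows "DD a p \<in> sym_comp n e"
proof -
  have "Poly_Mapping.keys m \<subseteq> {..n} \<and> monom_deg m = e" if "m \<in> Poly_Mapping.keys (DD a p)" for m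
  proof -
    \<comment> \<open>A nonzero coefficient of the sum needs a nonzero summand.\<close>
    from that obtain \<alpha> where "\<alpha> \<in> Poly_Mapping.keys a" "m + \<alpha> \<in> Poly_Mapping.keys p"
      by (auto simp: in_keys_iff lookup_DD elim!: sum.not_neutral_contains_not_neutral)
    then have "monom_deg \<alpha> = d" "Poly_Mapping.keys (m + \<alpha>) \<subseteq> {..n}" "monom_deg (m + \<alpha>) = e + d"
      using assms by (auto simp: sym_comp_def)
    then show ?thesis
      by (simp add: keys_add_nat)
  qed
  then show ?thesis
    by (simp add: sym_comp_def)
qed

text \<open>In equal degrees only a constant survives, so pairing with x^\<alpha> reads off one
  coefficient, up to \<alpha>!. Where \<alpha>! is invertible, w^\<alpha>/\<alpha>! is thus dual to
  x^\<alpha>.\<close>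

lemma DD_monomial_same_degree:
  assumes "a \<in> sym_comp n d" "monom_deg \<alpha> = d"
  shows "DD a (Poly_Mapping.single \<alpha> 1) =
    scal (Poly_Mapping.lookup a \<alpha> * of_nat (\<Prod>i\<in>Poly_Mapping.keys \<alpha>. fact (Poly_Mapping.lookup \<alpha> i))) 1"
proof (rule poly_mapping_eqI)
  fix m
  \<comment> \<open>Since \<alpha> and \<beta> have the same degree, \<open>m\<close> must have
    degree 0.\<close>
  have iff: "\<alpha> = m + \<beta> \<longleftrightarrow> m = 0 \<and> \<beta> = \<alpha>" if "\<beta> \<in> Poly_Mapping.keys a" for \<beta>
  proof -
    have "monom_deg \<beta> = d"
      using that assms by (auto simp: sym_comp_def)
    then show ?thesis
      using assms(2) by (metis add_cancel_right_left monom_deg_add monom_deg_eq_0_iff add_0)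
  qed
  have "Poly_Mapping.lookup (DD a (Poly_Mapping.single \<alpha> 1)) m =
     (\<Sum>\<beta>\<in>Poly_Mapping.keys a. if \<beta> = \<alpha> then (if m = 0 then
       Poly_Mapping.lookup a \<alpha> * of_nat (rising \<alpha> 0) else 0) else 0)"
    unfolding lookup_DD by (intro sum.cong) (simp_all add: lookup_single when_def iff)
  then show "Poly_Mapping.lookup (DD a (Poly_Mapping.single \<alpha> 1)) m = Poly_Mapping.lookup
      (scal (Poly_Mapping.lookup a \<alpha> *
        of_nat (\<Prod>i\<in>Poly_Mapping.keys \<alpha>. fact (Poly_Mapping.lookup \<alpha> i))) 1) m"
    by (auto simp: rising_def pochhammer_fact lookup_one when_def in_keys_iff)
qed

section \<open>Multiplication by scalars and monomials\<close>

lemma scal_mult_left: "scal c p * q = scal c (p * q)"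
  by (simp add: scal_def mult.assoc)

lemma scal_mult_right: "p * scal c q = scal c (p * q)"
  by (simp add: scal_def mult.left_commute)

lemma monomial_mult:
  "Poly_Mapping.single \<alpha> 1 * p =
    (\<Sum>m\<in>Poly_Mapping.keys p. Poly_Mapping.single (\<alpha> + m) (Poly_Mapping.lookup (p :: 'k::field mpol) m))"
  by (subst mpol_eq_sum_single[of p]) (simp add: sum_distrib_left mult_single)

lemma lookup_monomial_mult_add:
  "Poly_Mapping.lookup (Poly_Mapping.single \<alpha> 1 * p) (\<alpha> + m) = Poly_Mapping.lookup (p :: 'k::field mpol) m"
  by (auto simp: monomial_mult lookup_sum lookup_single when_def in_keys_iff)

lemma lookup_monomial_mult_eq_0:
  assumes "\<And>l. m \<noteq> \<alpha> + l"
  shows "Poly_Mapping.lookup (Poly_Mapping.single \<alpha> 1 * (p :: 'k::field mpol)) m = 0"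
  by (simp add: monomial_mult lookup_sum lookup_single assms[symmetric])

text \<open>Differentiating by \<alpha> and then multiplying by x^\<alpha> is diagonal on monomials,
  with eigenvalue m!/(m - \<alpha>)! at x^m, or 0 if x^\<alpha> does not divide x^m.\<close>

lemma lookup_monomial_mult_partials:
  assumes "finite S" "Poly_Mapping.keys \<alpha> \<subseteq> S"
  shows "Poly_Mapping.lookup (Poly_Mapping.single \<alpha> 1 * partials \<alpha> p) m =
    of_nat (\<Prod>i\<in>S. fact (Poly_Mapping.lookup \<alpha> i)) *
    of_nat (\<Prod>i\<in>S. Poly_Mapping.lookup m i choose Poly_Mapping.lookup \<alpha> i) *
    Poly_Mapping.lookup p m"
proof (cases "\<exists>l. m = \<alpha> + l")
  case True
  then obtain l where l: "m = \<alpha> + l" ..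
  show ?thesis
    using assms unfolding l lookup_monomial_mult_add lookup_partials
    by (simp add: rising_superset pochhammer_Suc_eq_fact_mult_binomial lookup_add prod.distrib
        add.commute mult.assoc)
next
  case False
  \<comment> \<open>If x^\<alpha> does not divide x^m, some exponent of \<alpha> is too large, and
    its binomial factor makes the right-hand side vanish too.\<close>
  have "\<exists>i\<in>S. Poly_Mapping.lookup m i < Poly_Mapping.lookup \<alpha> i"
  proof (rule ccontr)
    assume "\<not> ?thesis"
    then have "Poly_Mapping.lookup \<alpha> i \<le> Poly_Mapping.lookup m i" for i
      using assms(2) by (metis in_keys_iff linorder_not_less subsetD zero_le)
    then have "m = \<alpha> + (m - \<alpha>)"
      by (intro poly_mapping_eqI) (simp add: lookup_add lookup_minus)
    with False show False by blast
  qed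
  then have "(\<Prod>i\<in>S. Poly_Mapping.lookup m i choose Poly_Mapping.lookup \<alpha> i) = 0"
    using assms(1) by (auto simp: binomial_eq_0_iff)
  then show ?thesis
    using False by (subst lookup_monomial_mult_eq_0) auto
qed

subsection \<open>The divided power form of Euler's identity\<close>

text \<open>For d = 1 this is Euler's identity. All operators in the sum are diagonal on monomials,
  so it suffices to add their eigenvalues.\<close>

lemma euler_divided_power:
  fixes f :: "'k::field mpol"
  assumes "f \<in> sym_comp n e" and char: "CHAR('k) = 0 \<or> CHAR('k) > d"
  shows "(\<Sum>\<alpha>\<in>exps {..n} d. scal (1 / of_nat (\<Prod>i\<le>n. fact (Poly_Mapping.lookup \<alpha> i)))
      (Poly_Mapping.single \<alpha> 1 * partials \<alpha> f)) = scal (of_nat (e choose d)) f"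
    (is "?L = _")
proof (rule poly_mapping_eqI)
  fix m
  have "Poly_Mapping.lookup ?L m = (\<Sum>\<alpha>\<in>exps {..n} d.
      of_nat (\<Prod>i\<le>n. Poly_Mapping.lookup m i choose Poly_Mapping.lookup \<alpha> i) * Poly_Mapping.lookup f m)"
    unfolding lookup_sum
  proof (rule sum.cong)
    fix \<alpha> assume \<alpha>: "\<alpha> \<in> exps {..n} d"
    then have "Poly_Mapping.keys \<alpha> \<subseteq> {..n}"
      by (simp add: exps_def)
    with of_nat_prod_fact_neq_0[OF char \<alpha>] show "Poly_Mapping.lookup (scal (1 / of_nat (\<Prod>i\<le>n. fact (Poly_Mapping.lookup \<alpha> i)))
      (Poly_Mapping.single \<alpha> 1 * partials \<alpha> f)) m =
      of_nat (\<Prod>i\<le>n. Poly_Mapping.lookup m i choose Poly_Mapping.lookup \<alpha> i) * Poly_Mapping.lookup f m"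
      by (simp add: lookup_monomial_mult_partials[of "{..n}"] del: of_nat_prod)
  qed simp
  also have "\<dots> = of_nat ((\<Sum>i\<le>n. Poly_Mapping.lookup m i) choose d) * Poly_Mapping.lookup f m"
    by (simp add: vandermonde_exps[symmetric] sum_distrib_right)
  \<comment> \<open>Off the support of \<open>f\<close> both sides vanish; on it the exponents add
    up to \<open>e\<close>.\<close>
  also have "\<dots> = Poly_Mapping.lookup (scal (of_nat (e choose d)) f) m"
  proof (cases "m \<in> Poly_Mapping.keys f")
    case True
    then have "Poly_Mapping.keys m \<subseteq> {..n}" "monom_deg m = e"
      using assms(1) by (auto simp: sym_comp_def)
    then show ?thesis
      by (simp add: monom_deg_superset[of "{..n}"])
  qed (simp add: in_keys_iff)
  finally show "Poly_Mapping.lookup ?L m = Poly_Mapping.lookup (scal (of_nat (e choose d)) f) m" .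
qed

section \<open>Expansions in a basis and its dual\<close>

text \<open>Both sides are linear in \<open>e\<close>, and on a basis element duality leaves one
  summand. The coefficients are constant polynomials, hence the ring product.\<close>

lemma dual_basis_expansion:
  assumes "basis_upto (sym_comp n d) r q" "dual_basis_of n d r q qs" "e \<in> sym_comp n d"
  shows "e = (\<Sum>i\<le>r. DD (qs i) e * q i)"
proof -
  have "e \<in> mpol.span (q ` {..r})"
    using assms(1,3) by (simp add: basis_upto_def mpol_span_def)
  then show ?thesis
  proof (induction rule: mpol.span_induct_alt)
    case base
    show ?case by simp
  next
    case (step c x y)
    then obtain j where j: "j \<le> r" "x = q j" by auto
    have "(\<Sum>i\<le>r. DD (qs i) x * q i) = (\<Sum>i\<le>r. if i = j then q i else 0)"
      using assms(2) j by (intro sum.cong) (auto simp: dual_basis_of_def)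
    then have "(\<Sum>i\<le>r. DD (qs i) x * q i) = x"
      using j by simp
    moreover have "(\<Sum>i\<le>r. DD (qs i) (scal c x + y) * q i) =
        scal c (\<Sum>i\<le>r. DD (qs i) x * q i) + (\<Sum>i\<le>r. DD (qs i) y * q i)"
      by (simp add: DD_add_right DD_scal_right distrib_right sum.distrib scal_mult_left mpol.scale_sum_right)
    ultimately show ?case
      using step.IH by simp
  qed
qed

text \<open>The one-factor case, for \<open>f\<close> of any degree. The sum of the tensors of each
  basis element with its dual is independent of the basis, so the monomial basis may replace
  \<open>q\<close>.\<close>

lemma sum_dual_basis_DD:
  fixes f :: "'k::field mpol"
  assumes basis: "basis_upto (sym_comp n d) r q" and dual: "dual_basis_of n d r q qs"
    and f: "f \<in> sym_comp n e" and char: "CHAR('k) = 0 \<or> CHAR('k) > d"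
  shows "(\<Sum>i\<le>r. q i * DD (qs i) f) = scal (of_nat (e choose d)) f"
proof -
  let ?F = "\<lambda>\<alpha>. of_nat (\<Prod>i\<le>n. fact (Poly_Mapping.lookup \<alpha> i)) :: 'k"
  \<comment> \<open>Change of basis: the coordinate of x^\<alpha>/\<alpha>! at \<open>q i\<close> is
    the coefficient of w^\<alpha> in \<open>qs i\<close>.\<close>
  have monomial: "scal (1 / ?F \<alpha>) (Poly_Mapping.single \<alpha> 1) =
      (\<Sum>i\<le>r. scal (Poly_Mapping.lookup (qs i) \<alpha>) (q i))" if \<alpha>: "\<alpha> \<in> exps {..n} d" for \<alpha>
  proof -
    have F: "?F \<alpha> = of_nat (\<Prod>i\<in>Poly_Mapping.keys \<alpha>. fact (Poly_Mapping.lookup \<alpha> i))"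
      using \<alpha> by (intro arg_cong[where f = of_nat] prod.mono_neutral_right)
        (auto simp: exps_def in_keys_iff)
    have "Poly_Mapping.single \<alpha> 1 \<in> sym_comp n d"
      using \<alpha> by (simp add: sym_comp_def exps_def)
    note dual_basis_expansion[OF basis dual this]
    also have "(\<Sum>i\<le>r. DD (qs i) (Poly_Mapping.single \<alpha> 1) * q i) =
        (\<Sum>i\<le>r. scal (?F \<alpha>) (scal (Poly_Mapping.lookup (qs i) \<alpha>) (q i)))"
    proof (rule sum.cong)
      fix i assume "i \<in> {..r}"
      then have "qs i \<in> sym_comp n d"
        using dual by (simp add: dual_basis_of_def)
      then have "DD (qs i) (Poly_Mapping.single \<alpha> 1) = scal (Poly_Mapping.lookup (qs i) \<alpha> * ?F \<alpha>) 1"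
        unfolding F using \<alpha> by (intro DD_monomial_same_degree) (simp_all add: exps_def)
      then show "DD (qs i) (Poly_Mapping.single \<alpha> 1) * q i =
          scal (?F \<alpha>) (scal (Poly_Mapping.lookup (qs i) \<alpha>) (q i))"
        by (simp add: scal_mult_left mult.commute[of "?F \<alpha>"] del: of_nat_prod)
    qed simp
    finally have "Poly_Mapping.single \<alpha> 1 =
        scal (?F \<alpha>) (\<Sum>i\<le>r. scal (Poly_Mapping.lookup (qs i) \<alpha>) (q i))"
      by (simp only: mpol.scale_sum_right)
    then show ?thesis
      using of_nat_prod_fact_neq_0[OF char \<alpha>] by (simp del: of_nat_prod)
  qed
  have "(\<Sum>i\<le>r. q i * DD (qs i) f) =
      (\<Sum>i\<le>r. \<Sum>\<alpha>\<in>exps {..n} d. scal (Poly_Mapping.lookup (qs i) \<alpha>) (q i) * partials \<alpha> f)"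
  proof (rule sum.cong)
    fix i assume "i \<in> {..r}"
    then have "Poly_Mapping.keys (qs i) \<subseteq> exps {..n} d"
      using dual by (auto simp: dual_basis_of_def sym_comp_def exps_def)
    then show "q i * DD (qs i) f =
        (\<Sum>\<alpha>\<in>exps {..n} d. scal (Poly_Mapping.lookup (qs i) \<alpha>) (q i) * partials \<alpha> f)"
      by (simp add: DD_superset[OF finite_exps[OF finite_atMost]] sum_distrib_left scal_mult_left scal_mult_right)
  qed simp
  also have "\<dots> = (\<Sum>\<alpha>\<in>exps {..n} d. scal (1 / ?F \<alpha>) (Poly_Mapping.single \<alpha> 1) * partials \<alpha> f)"
    by (subst sum.swap) (simp add: monomial sum_distrib_right del: of_nat_prod)
  also have "\<dots> = scal (of_nat (e choose d)) f"
    using euler_divided_power[OF f char] by (simp only: scal_mult_left)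
  finally show ?thesis .
qed

text \<open>Each step of the induction on \<open>k\<close> contributes a factor (k + 1)d choose d.
  The bound for \<open>d\<close> stands separately because at \<open>k = 0\<close> the bound for
  \<open>k * d\<close> does not imply it.\<close>

lemma dual_basis_power_expansion:
  fixes f :: "'k::field mpol"
  assumes basis: "basis_upto (sym_comp n d) r q" and dual: "dual_basis_of n d r q qs"
    and "CHAR('k) = 0 \<or> CHAR('k) > k * d" "CHAR('k) = 0 \<or> CHAR('k) > d" "f \<in> sym_comp n (k * d)"
  shows "(\<Sum>\<iota>\<in>PiE {1..k} (\<lambda>_. {..r}). DD (\<Prod>j=1..k. qs (\<iota> j)) f * (\<Prod>j=1..k. q (\<iota> j))) =
    scal (of_nat (fact (k * d)) / of_nat (fact d) ^ k) f"
  using assms(3-)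
proof (induction k arbitrary: f)
  case 0
  then show ?case
    \<comment> \<open>There is a single empty index family, both products are 1, and the constant 1
      acts as the identity.\<close>
    using DD_monomial[of 0 f] by (simp add: partials_def)
next
  case (Suc k)
  let ?T = "\<lambda>k g. \<Sum>\<iota>\<in>PiE {1..k} (\<lambda>_. {..r}). DD (\<Prod>j=1..k. qs (\<iota> j)) g * (\<Prod>j=1..k. q (\<iota> j))"
  have set: "{1..Suc k} = insert (Suc k) {1..k}" by auto
  have upd: "(\<Prod>j=1..Suc k. h ((\<iota>(Suc k := y)) j)) = (\<Prod>j=1..k. h (\<iota> j)) * h y"
    for \<iota> :: "nat \<Rightarrow> nat" and y and h :: "nat \<Rightarrow> 'k mpol"
    by simp
  have "?T (Suc k) f = (\<Sum>y\<le>r. \<Sum>\<iota>\<in>PiE {1..k} (\<lambda>_. {..r}).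
      DD ((\<Prod>j=1..k. qs (\<iota> j)) * qs y) f * ((\<Prod>j=1..k. q (\<iota> j)) * q y))"
    \<comment> \<open>Rewriting by \<open>upd\<close> backwards exhibits the updated index families
      that \<open>sum_PiE_insert\<close> produces.\<close>
    unfolding upd[symmetric] unfolding set by (rule sum_PiE_insert) simp
  also have "\<dots> = (\<Sum>y\<le>r. q y * ?T k (DD (qs y) f))"
    \<comment> \<open>By \<open>DD_mult\<close> the last factor \<open>qs y\<close> acts on
      \<open>f\<close> first, leaving the sum of length \<open>k\<close> for
      \<open>DD (qs y) f\<close>.\<close>
    unfolding DD_mult sum_distrib_left by (simp add: ac_simps)
  also have "\<dots> = (\<Sum>y\<le>r. q y * scal (of_nat (fact (k * d)) / of_nat (fact d) ^ k) (DD (qs y) f))"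
  proof (intro sum.cong refl arg_cong2[where f = "(*)"])
    fix y assume "y \<in> {..r}"
    then have "DD (qs y) f \<in> sym_comp n (k * d)"
      using dual Suc.prems(3) by (intro DD_in_sym_comp[of _ n d]) (auto simp: dual_basis_of_def add.commute)
    then show "?T k (DD (qs y) f) = scal (of_nat (fact (k * d)) / of_nat (fact d) ^ k) (DD (qs y) f)"
      using Suc.prems by (intro Suc.IH) auto
  qed
  also have "\<dots> = scal (of_nat (fact (k * d)) / of_nat (fact d) ^ k) (\<Sum>y\<le>r. q y * DD (qs y) f)"
    by (simp add: scal_mult_right mpol.scale_sum_right)
  also have "\<dots> = scal (of_nat (fact (k * d)) / of_nat (fact d) ^ k)
      (scal (of_nat ((Suc k * d) choose d)) f)"
    by (simp only: sum_dual_basis_DD[OF basis dual Suc.prems(3,2)])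
  also have "\<dots> = scal (of_nat (fact (Suc k * d)) / of_nat (fact d) ^ Suc k) f"
  proof -
    have "(of_nat (fact (Suc k * d)) :: 'k) =
        of_nat (fact d) * of_nat (fact (k * d)) * of_nat ((Suc k * d) choose d)"
      using binomial_fact_lemma[of d "Suc k * d"] by (simp flip: of_nat_mult)
    then show ?thesis
      using of_nat_fact_neq_0[OF Suc.prems(2)] by simp
  qed
  finally show ?case .
qed

theorem corollary2p2p5:
  fixes k d n r :: nat
    and f :: "'k::alg_closed_field mpol"
    and q qs :: "nat \<Rightarrow> 'k mpol"
  assumes "k > 0" and "d > 0" and "n > 0"
    and "CHAR('k) = 0 \<or> CHAR('k) > k * d"
    and "f \<in> sym_comp n (k * d)"
    and "basis_upto (sym_comp n d) r q"
    and "dual_basis_of n d r q qs"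
  shows "scal (of_nat (fact (k * d)) / of_nat (fact d) ^ k) f =
    (\<Sum>\<iota>\<in>PiE {1..k} (\<lambda>_. {..r}). DD (\<Prod>j=1..k. qs (\<iota> j)) f * (\<Prod>j=1..k. q (\<iota> j)))"
proof -
  \<comment> \<open>Positivity of \<open>k\<close> yields the bound needed to invert d!.\<close>
  have "d \<le> k * d"
    using \<open>k > 0\<close> by simp
  then have "CHAR('k) = 0 \<or> CHAR('k) > d"
    using assms(4) by linarith
  then show ?thesis
    using assms by (intro dual_basis_power_expansion[symmetric])
qed

end
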